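(* The logic $\mathsf{CS4}$ has the finite frame property: for every formula $\varphi$ of the language $\mathcal L$, if $\varphi$ is falsifiable on some $\mathsf{CS4}$ frame, then $\varphi$ is falsifiable on some finite $\mathsf{CS4}$ frame; and if $\varphi$ is satisfiable on some $\mathsf{CS4}$ frame, then $\varphi$ is satisfiable on some finite $\mathsf{CS4}$ frame.
   Context: Fix a countably infinite set $\mathbb P$ of propositional variables. The language $\mathcal L$ is given by $\varphi ::= p \mid \bot \mid (\varphi\wedge\varphi)\mid(\varphi\vee\varphi)\mid(\varphi\to\varphi)\mid\Diamond\varphi\mid\Box\varphi$ with $p\in\mathbb P$. A bi-intuitionistic frame is a tuple $\mathcal F=(W,W^\bot,\preccurlyeq,\sqsubseteq)$ where $W$ is a set, $\preccurlyeq$ and $\sqsubseteq$ are preorders (reflexive and transitive relations) on $W$, and $W^\bot\subseteq W$ (the fallible worlds) is closed upward under both $\preccurlyeq$ and $\sqsubseteq$. The frame is back--up confluent if whenever $w\sqsubseteq v\preccurlyeq v'$ there is $w'$ with $w\preccurlyeq w'\sqsubseteq v'$. A $\mathsf{CS4}$ frame is a back--up confluent bi-intuitionistic frame. A valuation on $\mathcal F$ is a map $V:\mathbb P\to 2^W$ such that each $V(p)$ is upward closed under $\preccurlyeq$ and contains $W^\bot$; $\mathcal M=(\mathcal F,V)$ is a model. Satisfaction: $(\mathcal M,w)\models p$ iff $w\in V(p)$; $(\mathcal M,w)\models\bot$ iff $w\in W^\bot$; $\wedge,\vee$ are pointwise; $(\mathcal M,w)\models\varphi\to\psi$ iff for all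 $v$ with $w\preccurlyeq v$, $(\mathcal M,v)\models\varphi$ implies $(\mathcal M,v)\models\psi$; $(\mathcal M,w)\models\Diamond\varphi$ iff for all $u$ with $w\preccurlyeq u$ there is $v$ with $u\sqsubseteq v$ and $(\mathcal M,v)\models\varphi$; $(\mathcal M,w)\models\Box\varphi$ iff for all $u,v$ with $w\preccurlyeq u\sqsubseteq v$, $(\mathcal M,v)\models\varphi$. A formula $\varphi$ is falsifiable on a frame $\mathcal F$ if there is a valuation $V$ on $\mathcal F$ and a world $w\in W\setminus W^\bot$ with $((\mathcal F,V),w)\not\models\varphi$; it is satisfiable on $\mathcal F$ if there is a valuation $V$ and $w\in W\setminus W^\bot$ with $((\mathcal F,V),w)\models\varphi$. A frame is finite if $W$ is finite. *)

theory Defs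
  imports Main "HOL-Library.Countable" "HOL-Library.Infinite_Typeclass"
begin

datatype 'p fm =
    Var 'p
  | Bot
  | And "'p fm" "'p fm"
  | Or "'p fm" "'p fm"
  | Imp "'p fm" "'p fm"
  | Dia "'p fm"
  | Box "'p fm"

record 'w frame =
  worlds :: "'w set"
  fallible :: "'w set"
  int_rel :: "'w rel"
  mod_rel :: "'w rel"

definition upclosed :: "'w rel \<Rightarrow> 'w set \<Rightarrow> bool" where
  "upclosed r A \<longleftrightarrow> (\<forall>w v. w \<in> A \<and> (w, v) \<in> r \<longrightarrow> v \<in> A)"

definition bi_intuitionistic_frame :: "'w frame \<Rightarrow> bool" where
  "bi_intuitionistic_frame F \<longleftrightarrow>
     preorder_on (worlds F) (int_rel F) \<and>
     preorder_on (worlds F) (mod_rel F) \<and>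
     fallible F \<subseteq> worlds F \<and>
     upclosed (int_rel F) (fallible F) \<and>
     upclosed (mod_rel F) (fallible F)"

definition back_up_confluent :: "'w frame \<Rightarrow> bool" where
  "back_up_confluent F \<longleftrightarrow>
     (\<forall>w v v'. (w, v) \<in> mod_rel F \<and> (v, v') \<in> int_rel F \<longrightarrow>
        (\<exists>w'. (w, w') \<in> int_rel F \<and> (w', v') \<in> mod_rel F))"

definition CS4_frame :: "'w frame \<Rightarrow> bool" where
  "CS4_frame F \<longleftrightarrow> bi_intuitionistic_frame F \<and> back_up_confluent F"

definition finite_frame :: "'w frame \<Rightarrow> bool" where
  "finite_frame F \<longleftrightarrow> finite (worlds F)"

definition valuation :: "'w frame \<Rightarrow> ('p \<Rightarrow> 'w set) \<Rightarrow> bool" where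
  "valuation F V \<longleftrightarrow>
     (\<forall>p. V p \<subseteq> worlds F \<and> upclosed (int_rel F) (V p) \<and> fallible F \<subseteq> V p)"

text \<open>
  On a bi-intuitionistic frame both relations are contained in
  \<open>worlds F \<times> worlds F\<close>, so the quantifiers over related points
  below range over worlds only.
\<close>

primrec sat :: "'w frame \<Rightarrow> ('p \<Rightarrow> 'w set) \<Rightarrow> 'w \<Rightarrow> 'p fm \<Rightarrow> bool" where
  "sat F V w (Var p) \<longleftrightarrow> w \<in> V p"
| "sat F V w Bot \<longleftrightarrow> w \<in> fallible F"
| "sat F V w (And \<phi> \<psi>) \<longleftrightarrow> sat F V w \<phi> \<and> sat F V w \<psi>"
| "sat F V w (Or \<phi> \<psi>) \<longleftrightarrow> sat F V w \<phi> \<or> sat F V w \<psi>"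
| "sat F V w (Imp \<phi> \<psi>) \<longleftrightarrow>
     (\<forall>v. (w, v) \<in> int_rel F \<longrightarrow> sat F V v \<phi> \<longrightarrow> sat F V v \<psi>)"
| "sat F V w (Dia \<phi>) \<longleftrightarrow>
     (\<forall>u. (w, u) \<in> int_rel F \<longrightarrow> (\<exists>v. (u, v) \<in> mod_rel F \<and> sat F V v \<phi>))"
| "sat F V w (Box \<phi>) \<longleftrightarrow>
     (\<forall>u v. (w, u) \<in> int_rel F \<and> (u, v) \<in> mod_rel F \<longrightarrow> sat F V v \<phi>)"

definition falsifiable_on :: "'w frame \<Rightarrow> 'p fm \<Rightarrow> bool" where
  "falsifiable_on F \<phi> \<longleftrightarrow>
     (\<exists>V w. valuation F V \<and> w \<in> worlds F - fallible F \<and> \<not> sat F V w \<phi>)"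

definition satisfiable_on :: "'w frame \<Rightarrow> 'p fm \<Rightarrow> bool" where
  "satisfiable_on F \<phi> \<longleftrightarrow>
     (\<exists>V w. valuation F V \<and> w \<in> worlds F - fallible F \<and> sat F V w \<phi>)"

end

theory Submission
  imports Defs
begin

text \<open>
  Given a model and a finite set \<open>S\<close> of formulas containing \<open>Bot\<close>, the worlds of a finite
  model are pairs of the set \<open>\<Gamma>\<close> of members of \<open>S\<close> true at some world and a marker:
  either \<open>None\<close>, or \<open>Some \<chi>\<close> with \<open>Dia \<chi> \<in> S - \<Gamma>\<close>. The order
  \<open>\<preccurlyeq>\<close> is inclusion of the first components and ignores the markers, while \<open>\<sqsubseteq>\<close>
  preserves boxes and the marker, except that \<open>None\<close> may turn into any marker. Thus the world
  \<open>(\<Gamma>, Some \<chi>)\<close> has only modal successors falsifying \<open>\<chi>\<close> and witnesses the failure of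
  \<open>Dia \<chi>\<close>, while \<open>(\<Gamma>, None)\<close> has so many modal successors that confluence is automatic.
\<close>

section \<open>Preorders and persistence of truth in a \<open>CS4\<close> model\<close>

lemma preorder_on_worldsD:
  assumes "preorder_on A r"
  shows "\<And>x y. (x, y) \<in> r \<Longrightarrow> x \<in> A" "\<And>x y. (x, y) \<in> r \<Longrightarrow> y \<in> A"
    and "\<And>x. x \<in> A \<Longrightarrow> (x, x) \<in> r"
    and "\<And>x y z. (x, y) \<in> r \<Longrightarrow> (y, z) \<in> r \<Longrightarrow> (x, z) \<in> r"
  using assms unfolding preorder_on_def refl_on_def trans_def by blast+

locale CS4_model =
  fixes F :: "'w frame" and V :: "'p \<Rightarrow> 'w set"
  assumes CS4: "CS4_frame F" and val: "valuation F V"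
begin

lemma int_preorder: "preorder_on (worlds F) (int_rel F)"
  and mod_preorder: "preorder_on (worlds F) (mod_rel F)"
  using CS4 unfolding CS4_frame_def bi_intuitionistic_frame_def by blast+

lemmas int = preorder_on_worldsD[OF int_preorder]
lemmas mod = preorder_on_worldsD[OF mod_preorder]

lemma fallible_worlds: "w \<in> fallible F \<Longrightarrow> w \<in> worlds F"
  and fallible_int: "w \<in> fallible F \<Longrightarrow> (w, v) \<in> int_rel F \<Longrightarrow> v \<in> fallible F"
  and fallible_mod: "w \<in> fallible F \<Longrightarrow> (w, v) \<in> mod_rel F \<Longrightarrow> v \<in> fallible F"
  using CS4 unfolding CS4_frame_def bi_intuitionistic_frame_def upclosed_def by blast+

lemma confluent:
  assumes "(w, v) \<in> mod_rel F" "(v, v') \<in> int_rel F"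
  obtains w' where "(w, w') \<in> int_rel F" "(w', v') \<in> mod_rel F"
  using assms CS4 unfolding CS4_frame_def back_up_confluent_def by blast

lemma sat_mono: "sat F V w \<psi> \<Longrightarrow> (w, v) \<in> int_rel F \<Longrightarrow> sat F V v \<psi>"
proof (induction \<psi>)
  case (Var p)
  then show ?case using val unfolding valuation_def upclosed_def by auto
qed (auto intro: fallible_int int(4) dest: int(4))

text \<open>Fallibility is inherited along both relations, which carries the induction. For
  \<open>Dia\<close> the witness is the reached world itself, by reflexivity of
  \<open>mod_rel F\<close>.\<close>

lemma sat_fallible: "w \<in> fallible F \<Longrightarrow> sat F V w \<psi>"
proof (induction \<psi> arbitrary: w)
  case (Var p)
  then show ?case using val unfolding valuation_def by auto
next
  case (Dia \<psi>)
  then show ?case by simp (meson fallible_int fallible_worlds mod(3))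
qed (auto intro: fallible_int fallible_mod)

text \<open>Confluence moves an order step that follows a modal step in front of it, and
  transitivity then merges the two modal steps. This ensures that actual modal steps satisfy the box
  clause of \<open>filtration\<close>.\<close>

lemma sat_Box_mod:
  assumes "sat F V w (Box \<psi>)" "(w, v) \<in> mod_rel F"
  shows "sat F V v (Box \<psi>)"
  unfolding sat.simps
proof safe
  fix x y assume "(v, x) \<in> int_rel F" "(x, y) \<in> mod_rel F"
  moreover obtain u where "(w, u) \<in> int_rel F" "(u, x) \<in> mod_rel F"
    using confluent assms(2) calculation(1) by blast
  ultimately show "sat F V y \<psi>" using assms(1) mod(4)[of u x y] by auto
qed

lemma sat_Box_refl: "sat F V w (Box \<psi>) \<Longrightarrow> w \<in> worlds F \<Longrightarrow> sat F V w \<psi>"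
  using int(3) mod(3) by auto

text \<open>A world refuting \<open>Dia \<psi>\<close> has some \<open>u\<close> above it with no
  modal successor satisfying \<psi>. By transitivity the same holds of the modal successors of those
  successors, so \<open>Dia \<psi>\<close> itself fails there. This stronger form is what a marker
  records.\<close>

lemma not_sat_DiaE:
  assumes "\<not> sat F V w (Dia \<psi>)"
  obtains u where "(w, u) \<in> int_rel F" "\<And>v. (u, v) \<in> mod_rel F \<Longrightarrow> \<not> sat F V v (Dia \<psi>)"
proof -
  obtain u where u: "(w, u) \<in> int_rel F" "\<And>v. (u, v) \<in> mod_rel F \<Longrightarrow> \<not> sat F V v \<psi>"
    using assms by auto
  have "\<not> sat F V v (Dia \<psi>)" if "(u, v) \<in> mod_rel F" for v
    using u(2) that int(3) mod(2,4) by (metis sat.simps(6))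
  with u(1) that show thesis by blast
qed

section \<open>The finite frame of marked types\<close>

definition type_of :: "'p fm set \<Rightarrow> 'w \<Rightarrow> 'p fm set" where
  "type_of S w = {\<psi> \<in> S. sat F V w \<psi>}"

definition filtration_worlds :: "'p fm set \<Rightarrow> ('p fm set \<times> 'p fm option) set" where
  "filtration_worlds S =
     {(type_of S w, m) |w m. w \<in> worlds F \<and> (\<forall>\<chi>. m = Some \<chi> \<longrightarrow> Dia \<chi> \<in> S - type_of S w)}"

definition filtration :: "'p fm set \<Rightarrow> ('p fm set \<times> 'p fm option) frame" where
  "filtration S = \<lparr>
     worlds = filtration_worlds S,
     fallible = {(\<Gamma>, m) \<in> filtration_worlds S. Bot \<in> \<Gamma>},
     int_rel = {((\<Gamma>, m), (\<Delta>, n)). (\<Gamma>, m) \<in> filtration_worlds S \<and> (\<Delta>, n) \<in> filtration_worlds S \<and>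
        \<Gamma> \<subseteq> \<Delta>},
     mod_rel = {((\<Gamma>, m), (\<Delta>, n)). (\<Gamma>, m) \<in> filtration_worlds S \<and> (\<Delta>, n) \<in> filtration_worlds S \<and>
        (m = None \<or> n = m) \<and> (Bot \<in> \<Gamma> \<longrightarrow> Bot \<in> \<Delta>) \<and> (\<forall>\<chi>. Box \<chi> \<in> \<Gamma> \<longrightarrow> Box \<chi> \<in> \<Delta>)}\<rparr>"

text \<open>The disjunct \<open>Bot \<in> \<Gamma>\<close> puts the fallible worlds into the
  valuation even for variables outside \<open>S\<close>.\<close>

definition filtration_val :: "'p fm set \<Rightarrow> 'p \<Rightarrow> ('p fm set \<times> 'p fm option) set" where
  "filtration_val S p = {(\<Gamma>, m) \<in> filtration_worlds S. Var p \<in> \<Gamma> \<or> Bot \<in> \<Gamma>}"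

lemma None_in_filtration: "w \<in> worlds F \<Longrightarrow> (type_of S w, None) \<in> filtration_worlds S"
  unfolding filtration_worlds_def by auto

lemma filtration_worldsE:
  assumes "(\<Gamma>, m) \<in> filtration_worlds S"
  obtains w where "w \<in> worlds F" "\<Gamma> = type_of S w"
    "\<forall>\<chi>. m = Some \<chi> \<longrightarrow> Dia \<chi> \<in> S \<and> \<not> sat F V w (Dia \<chi>)"
  using assms unfolding filtration_worlds_def type_of_def by auto

lemma finite_filtration_worlds:
  assumes "finite S"
  shows "finite (filtration_worlds S)"
proof -
  \<comment> \<open>Markers come from the preimage of \<open>S\<close> under the injective
    constructor \<open>Dia\<close>.\<close>
  have "finite (Dia -` S)" using assms by (rule finite_vimageI) (simp add: inj_def)
  moreover have "filtration_worlds S \<subseteq> Pow S \<times> insert None (Some ` (Dia -` S))"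
    unfolding filtration_worlds_def type_of_def by (auto simp del: sat.simps) (metis imageI not_None_eq vimageI2)
  ultimately show ?thesis using assms by (meson finite.insertI finite_Pow_iff finite_SigmaI finite_imageI finite_subset)
qed

lemma filtration_CS4: "CS4_frame (filtration S)"
proof -
  have "back_up_confluent (filtration S)"
    unfolding back_up_confluent_def
  proof safe
    fix \<Gamma> m \<Delta> n \<Theta> k
    assume *: "((\<Gamma>, m), (\<Delta>, n)) \<in> mod_rel (filtration S)" "((\<Delta>, n), (\<Theta>, k)) \<in> int_rel (filtration S)"
    then have "(\<Gamma>, None) \<in> filtration_worlds S"
      unfolding filtration_def by (auto elim!: filtration_worldsE intro: None_in_filtration)
    \<comment> \<open>Erasing the marker is an order step, and from \<open>None\<close> every marker
      \<open>k\<close> is reachable. \<open>Bot\<close> and the boxes pass from \<Gamma> to \<Delta>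
      by the modal step and on to \<Theta> by inclusion.\<close>
    then show "\<exists>w'. ((\<Gamma>, m), w') \<in> int_rel (filtration S) \<and> (w', (\<Theta>, k)) \<in> mod_rel (filtration S)"
      using * unfolding filtration_def by (intro exI[of _ "(\<Gamma>, None)"]) auto
  qed
  then show ?thesis
    unfolding CS4_frame_def bi_intuitionistic_frame_def preorder_on_def refl_on_def trans_def upclosed_def
    by (auto simp: filtration_def)
qed

lemma filtration_valuation: "valuation (filtration S) (filtration_val S)"
  unfolding valuation_def upclosed_def filtration_val_def by (auto simp: filtration_def)

end

section \<open>Subformulas and the truth lemma\<close>

primrec subfms :: "'p fm \<Rightarrow> 'p fm set" where
  "subfms (Var p) = {Var p}"
| "subfms Bot = {Bot}"
| "subfms (And \<phi> \<psi>) = insert (And \<phi> \<psi>) (subfms \<phi> \<union> subfms \<psi>)"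
| "subfms (Or \<phi> \<psi>) = insert (Or \<phi> \<psi>) (subfms \<phi> \<union> subfms \<psi>)"
| "subfms (Imp \<phi> \<psi>) = insert (Imp \<phi> \<psi>) (subfms \<phi> \<union> subfms \<psi>)"
| "subfms (Dia \<phi>) = insert (Dia \<phi>) (subfms \<phi>)"
| "subfms (Box \<phi>) = insert (Box \<phi>) (subfms \<phi>)"

lemma finite_subfms: "finite (subfms \<phi>)"
  by (induction \<phi>) auto

lemma self_in_subfms: "\<phi> \<in> subfms \<phi>"
  by (cases \<phi>) auto

context CS4_model
begin

text \<open>Truth does not depend on the marker: \<open>Imp\<close>, \<open>Dia\<close> and
  \<open>Box\<close> all begin with an order step, which may change it freely.\<close>

lemma filtration_truth:
  assumes "Bot \<in> S" "subfms \<psi> \<subseteq> S" "(\<Gamma>, m) \<in> filtration_worlds S"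
  shows "sat (filtration S) (filtration_val S) (\<Gamma>, m) \<psi> \<longleftrightarrow> \<psi> \<in> \<Gamma>"
  using assms(2,3)
proof (induction \<psi> arbitrary: \<Gamma> m)
  case (Var p)
  then obtain w where "w \<in> worlds F" "\<Gamma> = type_of S w" by (auto elim: filtration_worldsE)
  \<comment> \<open>If \<open>Bot \<in> \<Gamma>\<close>, then \<open>w\<close> is fallible and
    satisfies \<open>Var p\<close>, so the extra disjunct of the valuation adds nothing
    here.\<close>
  with Var sat_fallible[of w "Var p"] show ?case by (auto simp: filtration_val_def type_of_def)
next
  case Bot
  then show ?case by (auto simp: filtration_def)
next
  case (And \<psi>1 \<psi>2)
  then obtain w where "w \<in> worlds F" "\<Gamma> = type_of S w" by (auto elim: filtration_worldsE)
  with And self_in_subfms[of \<psi>1] self_in_subfms[of \<psi>2] show ?case by (auto simp: type_of_def)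
next
  case (Or \<psi>1 \<psi>2)
  then obtain w where "w \<in> worlds F" "\<Gamma> = type_of S w" by (auto elim: filtration_worldsE)
  with Or self_in_subfms[of \<psi>1] self_in_subfms[of \<psi>2] show ?case by (auto simp: type_of_def)
next
  case (Imp \<psi>1 \<psi>2)
  from Imp.prems(2) obtain w where w: "w \<in> worlds F" "\<Gamma> = type_of S w"
    by (auto elim: filtration_worldsE)
  have S: "Imp \<psi>1 \<psi>2 \<in> S" "\<psi>1 \<in> S" "\<psi>2 \<in> S" "subfms \<psi>1 \<subseteq> S" "subfms \<psi>2 \<subseteq> S"
    using Imp.prems(1) self_in_subfms[of \<psi>1] self_in_subfms[of \<psi>2] by auto
  have IH: "sat (filtration S) (filtration_val S) (\<Delta>, n) \<psi>1 \<longleftrightarrow> \<psi>1 \<in> \<Delta>"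
    "sat (filtration S) (filtration_val S) (\<Delta>, n) \<psi>2 \<longleftrightarrow> \<psi>2 \<in> \<Delta>"
    if "(\<Delta>, n) \<in> filtration_worlds S" for \<Delta> n
    using Imp.IH S that by blast+
  have sat_iff: "sat (filtration S) (filtration_val S) (\<Gamma>, m) (Imp \<psi>1 \<psi>2) \<longleftrightarrow>
      (\<forall>\<Delta> n. (\<Delta>, n) \<in> filtration_worlds S \<longrightarrow> \<Gamma> \<subseteq> \<Delta> \<longrightarrow> \<psi>1 \<in> \<Delta> \<longrightarrow> \<psi>2 \<in> \<Delta>)"
    using Imp.prems(2) IH by (auto simp: filtration_def[of S])
  show ?case
  proof
    assume L: "sat (filtration S) (filtration_val S) (\<Gamma>, m) (Imp \<psi>1 \<psi>2)"
    have "sat F V v \<psi>2" if "(w, v) \<in> int_rel F" "sat F V v \<psi>1" for v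
    proof -
      have "\<Gamma> \<subseteq> type_of S v" using w that(1) sat_mono by (auto simp: type_of_def)
      moreover have "\<psi>1 \<in> type_of S v" using S that by (simp add: type_of_def)
      ultimately have "\<psi>2 \<in> type_of S v"
        using L None_in_filtration[of v S] int(2)[OF that(1)] unfolding sat_iff by blast
      then show ?thesis by (simp add: type_of_def)
    qed
    then show "Imp \<psi>1 \<psi>2 \<in> \<Gamma>" using S w by (simp add: type_of_def)
  next
    assume R: "Imp \<psi>1 \<psi>2 \<in> \<Gamma>"
    show "sat (filtration S) (filtration_val S) (\<Gamma>, m) (Imp \<psi>1 \<psi>2)"
      unfolding sat_iff
    proof (intro allI impI)
      fix \<Delta> n assume *: "(\<Delta>, n) \<in> filtration_worlds S" "\<Gamma> \<subseteq> \<Delta>" "\<psi>1 \<in> \<Delta>"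
      \<comment> \<open>The implication belongs to \<Delta> as well, so it holds at any world
        realising \<Delta> and can be applied there by reflexivity.\<close>
      then obtain v where "v \<in> worlds F" "\<Delta> = type_of S v" by (auto elim: filtration_worldsE)
      with R * S int(3)[of v] show "\<psi>2 \<in> \<Delta>" by (auto simp: type_of_def)
    qed
  qed
next
  case (Dia \<psi>)
  from Dia.prems(2) obtain w where w: "w \<in> worlds F" "\<Gamma> = type_of S w"
    by (auto elim: filtration_worldsE)
  have S: "Dia \<psi> \<in> S" "\<psi> \<in> S" "subfms \<psi> \<subseteq> S"
    using Dia.prems(1) self_in_subfms[of \<psi>] by auto
  have IH: "sat (filtration S) (filtration_val S) (\<Delta>, n) \<psi> \<longleftrightarrow> \<psi> \<in> \<Delta>"
    if "(\<Delta>, n) \<in> filtration_worlds S" for \<Delta> n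
    using Dia.IH S that by blast
  show ?case
  proof
    assume L: "sat (filtration S) (filtration_val S) (\<Gamma>, m) (Dia \<psi>)"
    show "Dia \<psi> \<in> \<Gamma>"
    proof (rule ccontr)
      assume not: "Dia \<psi> \<notin> \<Gamma>"
      \<comment> \<open>An order step to the marker \<open>Some \<psi>\<close> is allowed exactly
        because \<open>Dia \<psi>\<close> is missing from \<Gamma>. Every modal successor keeps this
        marker and so has a type realised by a world refuting \<open>Dia \<psi>\<close>.\<close>
      then have "(\<Gamma>, Some \<psi>) \<in> filtration_worlds S"
        using w S unfolding filtration_worlds_def by blast
      then have "((\<Gamma>, m), (\<Gamma>, Some \<psi>)) \<in> int_rel (filtration S)"
        using Dia.prems(2) by (simp add: filtration_def)
      with L obtain \<Delta> n where "((\<Gamma>, Some \<psi>), (\<Delta>, n)) \<in> mod_rel (filtration S)"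
        "sat (filtration S) (filtration_val S) (\<Delta>, n) \<psi>" by (metis sat.simps(6) surj_pair)
      then have \<Delta>: "(\<Delta>, Some \<psi>) \<in> filtration_worlds S" "\<psi> \<in> \<Delta>"
        using IH by (auto simp: filtration_def[of S])
      from \<Delta>(1) obtain v where v: "v \<in> worlds F" "\<Delta> = type_of S v" "\<not> sat F V v (Dia \<psi>)"
        by (auto elim!: filtration_worldsE simp del: sat.simps)
      \<comment> \<open>Every world above \<open>v\<close> satisfies \<psi> by persistence and sees
        itself, contradicting the marker.\<close>
      have "sat F V v (Dia \<psi>)"
        using v(2) \<Delta>(2) sat_mono[of v \<psi>] int(2)[of v] mod(3) by (auto simp: type_of_def)
      with v show False by blast
    qed
  next
    assume R: "Dia \<psi> \<in> \<Gamma>"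
    have "\<exists>q. ((\<Delta>, n), q) \<in> mod_rel (filtration S) \<and> sat (filtration S) (filtration_val S) q \<psi>"
      if *: "((\<Gamma>, m), (\<Delta>, n)) \<in> int_rel (filtration S)" for \<Delta> n
    proof -
      from * have \<Delta>: "(\<Delta>, n) \<in> filtration_worlds S" "Dia \<psi> \<in> \<Delta>"
        using R by (auto simp: filtration_def)
      from \<Delta>(1) obtain x where x: "x \<in> worlds F" "\<Delta> = type_of S x"
        and n: "\<forall>\<chi>. n = Some \<chi> \<longrightarrow> Dia \<chi> \<in> S \<and> \<not> sat F V x (Dia \<chi>)"
        by (auto elim: filtration_worldsE simp del: sat.simps)
      \<comment> \<open>The witness for \<psi> must respect the marker \<open>n\<close>. With
        \<open>None\<close>, \<open>u\<close> is \<open>x\<close> itself; with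
        \<open>Some \<chi>\<close>, \<open>u\<close> is a world above \<open>x\<close> whose modal
        successors all refute \<open>Dia \<chi>\<close>, so the successor \<open>v\<close> found
        below may carry the same marker.\<close>
      obtain u where u: "(x, u) \<in> int_rel F"
        "\<And>v \<chi>. n = Some \<chi> \<Longrightarrow> (u, v) \<in> mod_rel F \<Longrightarrow> \<not> sat F V v (Dia \<chi>)"
      proof (cases n)
        case None
        with that int(3)[OF x(1)] show thesis by simp
      next
        case (Some \<chi>)
        with n not_sat_DiaE[of x \<chi>] that show thesis by (metis option.inject)
      qed
      from \<Delta>(2) x u obtain v where v: "(u, v) \<in> mod_rel F" "sat F V v \<psi>"
        by (auto simp: type_of_def)
      have "(type_of S v, n) \<in> filtration_worlds S"
        using mod(2)[OF v(1)] u(2)[OF _ v(1)] n unfolding filtration_worlds_def type_of_def by blast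
      moreover have "\<psi> \<in> type_of S v" using v S by (simp add: type_of_def)
      \<comment> \<open>\<open>Bot\<close> and the boxes travel from \<open>x\<close> up to
        \<open>u\<close> by persistence, then from \<open>u\<close> to \<open>v\<close> along the
        modal step.\<close>
      moreover have "Bot \<in> \<Delta> \<longrightarrow> Bot \<in> type_of S v"
        using x fallible_int[OF _ u(1)] fallible_mod[OF _ v(1)] by (auto simp: type_of_def)
      moreover have "Box \<chi> \<in> \<Delta> \<longrightarrow> Box \<chi> \<in> type_of S v" for \<chi>
        using x sat_mono[OF _ u(1), of "Box \<chi>"] sat_Box_mod[OF _ v(1), of \<chi>]
        by (auto simp: type_of_def simp del: sat.simps)
      ultimately show ?thesis
        using \<Delta>(1) IH by (intro exI[of _ "(type_of S v, n)"]) (auto simp: filtration_def[of S])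
    qed
    then show "sat (filtration S) (filtration_val S) (\<Gamma>, m) (Dia \<psi>)" by simp
  qed
next
  case (Box \<psi>)
  from Box.prems(2) obtain w where w: "w \<in> worlds F" "\<Gamma> = type_of S w"
    by (auto elim: filtration_worldsE)
  have S: "Box \<psi> \<in> S" "\<psi> \<in> S" "subfms \<psi> \<subseteq> S"
    using Box.prems(1) self_in_subfms[of \<psi>] by auto
  have IH: "sat (filtration S) (filtration_val S) (\<Delta>, n) \<psi> \<longleftrightarrow> \<psi> \<in> \<Delta>"
    if "(\<Delta>, n) \<in> filtration_worlds S" for \<Delta> n
    using Box.IH S that by blast
  show ?case
  proof
    assume L: "sat (filtration S) (filtration_val S) (\<Gamma>, m) (Box \<psi>)"
    have "sat F V v \<psi>" if *: "(w, u) \<in> int_rel F" "(u, v) \<in> mod_rel F" for u v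
    proof -
      \<comment> \<open>The marker \<open>None\<close> on both types leaves no marker constraint, so
        the path through \<open>u\<close> and \<open>v\<close> is copied into the
        filtration.\<close>
      have worlds: "(type_of S u, None) \<in> filtration_worlds S" "(type_of S v, None) \<in> filtration_worlds S"
        using * int(2) mod(2) None_in_filtration by blast+
      have "((\<Gamma>, m), (type_of S u, None)) \<in> int_rel (filtration S)"
        using worlds Box.prems(2) w sat_mono[OF _ *(1)] by (auto simp: filtration_def type_of_def)
      moreover have "((type_of S u, None), (type_of S v, None)) \<in> mod_rel (filtration S)"
        using worlds fallible_mod[OF _ *(2)] sat_Box_mod[OF _ *(2)]
        by (auto simp: filtration_def type_of_def simp del: sat.simps(7))
      ultimately have "sat (filtration S) (filtration_val S) (type_of S v, None) \<psi>"
        using L by auto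
      then show ?thesis using IH worlds by (simp add: type_of_def)
    qed
    then show "Box \<psi> \<in> \<Gamma>" using w S by (auto simp: type_of_def)
  next
    assume R: "Box \<psi> \<in> \<Gamma>"
    have "sat (filtration S) (filtration_val S) (\<Theta>, k) \<psi>"
      if "((\<Gamma>, m), (\<Delta>, n)) \<in> int_rel (filtration S)" "((\<Delta>, n), (\<Theta>, k)) \<in> mod_rel (filtration S)"
      for \<Delta> n \<Theta> k
    proof -
      \<comment> \<open>Order steps enlarge the type and modal steps keep boxes, so
        \<open>Box \<psi>\<close> survives up to \<Theta>, where reflexivity at a realising world
        strips the box.\<close>
      have *: "(\<Theta>, k) \<in> filtration_worlds S" "Box \<psi> \<in> \<Theta>"
        using that R by (auto simp: filtration_def)
      then obtain v where "v \<in> worlds F" "\<Theta> = type_of S v" by (auto elim: filtration_worldsE)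
      with * S sat_Box_refl[of v \<psi>] have "\<psi> \<in> \<Theta>" by (auto simp: type_of_def simp del: sat.simps)
      with IH *(1) show ?thesis by blast
    qed
    then show "sat (filtration S) (filtration_val S) (\<Gamma>, m) (Box \<psi>)" by simp blast
  qed
qed

end

section \<open>Transfer of the finite frame to natural numbers\<close>

definition pullback_frame :: "('b \<Rightarrow> 'a) \<Rightarrow> 'b set \<Rightarrow> 'a frame \<Rightarrow> 'b frame" where
  "pullback_frame h I F = \<lparr>
     worlds = I,
     fallible = {i \<in> I. h i \<in> fallible F},
     int_rel = {(i, j) \<in> I \<times> I. (h i, h j) \<in> int_rel F},
     mod_rel = {(i, j) \<in> I \<times> I. (h i, h j) \<in> mod_rel F}\<rparr>"

text \<open>Confluence is the one condition asserting existence: its witness in \<open>F\<close> has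
  a preimage in \<open>I\<close> by surjectivity of \<open>h\<close>.\<close>

lemma pullback_CS4:
  assumes "CS4_frame F" "h ` I = worlds F"
  shows "CS4_frame (pullback_frame h I F)"
proof -
  from assms have int: "preorder_on (worlds F) (int_rel F)" and mod: "preorder_on (worlds F) (mod_rel F)"
    and up: "upclosed (int_rel F) (fallible F)" "upclosed (mod_rel F) (fallible F)"
    unfolding CS4_frame_def bi_intuitionistic_frame_def by auto
  have confl: "back_up_confluent (pullback_frame h I F)"
    unfolding back_up_confluent_def
  proof safe
    fix i j k
    assume *: "(i, j) \<in> mod_rel (pullback_frame h I F)" "(j, k) \<in> int_rel (pullback_frame h I F)"
    then have "(h i, h j) \<in> mod_rel F" "(h j, h k) \<in> int_rel F" by (auto simp: pullback_frame_def)
    then obtain x where x: "(h i, x) \<in> int_rel F" "(x, h k) \<in> mod_rel F"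
      using assms(1) unfolding CS4_frame_def back_up_confluent_def by blast
    obtain l where "l \<in> I" "x = h l"
      using preorder_on_worldsD(2)[OF int x(1)] assms(2) by auto
    with * x show "\<exists>l. (i, l) \<in> int_rel (pullback_frame h I F) \<and> (l, k) \<in> mod_rel (pullback_frame h I F)"
      by (auto simp: pullback_frame_def)
  qed
  have preorder: "preorder_on I {(i, j) \<in> I \<times> I. (h i, h j) \<in> r}" if "preorder_on (worlds F) r" for r
    using that assms(2) unfolding preorder_on_def refl_on_def trans_def by blast
  have upclosed: "upclosed {(i, j) \<in> I \<times> I. (h i, h j) \<in> r} {i \<in> I. h i \<in> A}"
    if "upclosed r A" for r A
    using that unfolding upclosed_def by blast
  from confl preorder[OF int] preorder[OF mod] upclosed[OF up(1)] upclosed[OF up(2)] show ?thesis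
    unfolding CS4_frame_def bi_intuitionistic_frame_def by (auto simp: pullback_frame_def)
qed

lemma pullback_valuation:
  assumes "valuation F V"
  shows "valuation (pullback_frame h I F) (\<lambda>p. {i \<in> I. h i \<in> V p})"
  using assms unfolding valuation_def upclosed_def pullback_frame_def by simp blast

text \<open>By surjectivity, quantifying over related points of \<open>F\<close> amounts to
  quantifying over indices in \<open>I\<close>, so each clause of \<open>sat\<close>
  transfers.\<close>

lemma pullback_sat:
  assumes "CS4_frame F" "h ` I = worlds F" "i \<in> I"
  shows "sat (pullback_frame h I F) (\<lambda>p. {i \<in> I. h i \<in> V p}) i \<psi> \<longleftrightarrow> sat F V (h i) \<psi>"
proof -
  from assms(1) have int: "preorder_on (worlds F) (int_rel F)" and mod: "preorder_on (worlds F) (mod_rel F)"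
    unfolding CS4_frame_def bi_intuitionistic_frame_def by auto
  have int_image: "\<exists>j\<in>I. y = h j" if "(x, y) \<in> int_rel F" for x y
    using preorder_on_worldsD(2)[OF int that] assms(2) by auto
  have mod_image: "\<exists>j\<in>I. y = h j" if "(x, y) \<in> mod_rel F" for x y
    using preorder_on_worldsD(2)[OF mod that] assms(2) by auto
  have all_int: "(\<forall>y. (x, y) \<in> int_rel F \<longrightarrow> P y) \<longleftrightarrow> (\<forall>j\<in>I. (x, h j) \<in> int_rel F \<longrightarrow> P (h j))" for x P
    using int_image by blast
  have all_mod: "(\<forall>y. (x, y) \<in> mod_rel F \<longrightarrow> P y) \<longleftrightarrow> (\<forall>j\<in>I. (x, h j) \<in> mod_rel F \<longrightarrow> P (h j))" for x P
    using mod_image by blast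
  have ex_mod: "(\<exists>y. (x, y) \<in> mod_rel F \<and> P y) \<longleftrightarrow> (\<exists>j\<in>I. (x, h j) \<in> mod_rel F \<and> P (h j))" for x P
    using mod_image by blast
  show ?thesis using assms(3)
  proof (induction \<psi> arbitrary: i)
    case (Imp \<psi>1 \<psi>2)
    then show ?case by (simp add: pullback_frame_def all_int) blast
  next
    case (Dia \<psi>)
    then show ?case by (simp add: pullback_frame_def all_int ex_mod) blast
  next
    case (Box \<psi>)
    \<comment> \<open>The joint quantifier over \<open>u\<close> and \<open>v\<close> is split so
      that \<open>all_int\<close> and \<open>all_mod\<close> can rewrite it.\<close>
    have "sat F V (h i) (Box \<psi>) \<longleftrightarrow>
        (\<forall>u. (h i, u) \<in> int_rel F \<longrightarrow> (\<forall>v. (u, v) \<in> mod_rel F \<longrightarrow> sat F V v \<psi>))" by auto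
    with Box show ?case unfolding all_int all_mod by (simp add: pullback_frame_def) blast
  qed (auto simp: pullback_frame_def)
qed

text \<open>An equivalence at one infallible world serves falsifiability and satisfiability at
  once.\<close>

lemma finite_model_agreeing_on_formula:
  fixes F :: "'w frame" and \<phi> :: "'p fm"
  assumes "CS4_frame F" "valuation F V" "w \<in> worlds F - fallible F"
  obtains G :: "nat frame" and U v where "CS4_frame G" "finite_frame G" "valuation G U"
    "v \<in> worlds G - fallible G" "sat G U v \<phi> \<longleftrightarrow> sat F V w \<phi>"
proof -
  interpret CS4_model F V using assms by unfold_locales
  define S where "S = insert Bot (subfms \<phi>)"
  have fin: "finite (filtration_worlds S)"
    unfolding S_def by (simp add: finite_filtration_worlds finite_subfms)
  then obtain h where h: "h ` {0..<card (filtration_worlds S)} = filtration_worlds S"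
    by (metis ex_bij_betw_nat_finite bij_betw_imp_surj_on)
  define I where "I = {0..<card (filtration_worlds S)}"
  have hI: "h ` I = worlds (filtration S)" using h by (simp add: I_def filtration_def)
  have w: "(type_of S w, None) \<in> filtration_worlds S" using assms(3) None_in_filtration by blast
  then obtain i where i: "i \<in> I" "h i = (type_of S w, None)" using h unfolding I_def by (metis imageE)
  let ?G = "pullback_frame h I (filtration S)"
  let ?U = "\<lambda>p. {i \<in> I. h i \<in> filtration_val S p}"
  show thesis
  proof
    show "CS4_frame ?G" by (rule pullback_CS4[OF filtration_CS4 hI])
    show "finite_frame ?G" by (simp add: finite_frame_def pullback_frame_def I_def)
    show "valuation ?G ?U" by (rule pullback_valuation[OF filtration_valuation])
    \<comment> \<open>Since \<open>w\<close> is infallible, \<open>Bot\<close> is absent from its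
      type.\<close>
    show "i \<in> worlds ?G - fallible ?G"
      using i assms(3) by (simp add: pullback_frame_def filtration_def type_of_def)
    have "sat ?G ?U i \<phi> \<longleftrightarrow> \<phi> \<in> type_of S w"
      using pullback_sat[OF filtration_CS4 hI i(1)] i(2) filtration_truth[OF _ _ w, of \<phi>]
      unfolding S_def by auto
    then show "sat ?G ?U i \<phi> \<longleftrightarrow> sat F V w \<phi>"
      by (simp add: type_of_def S_def self_in_subfms)
  qed
qed

theorem mainTheorem1:
  fixes \<phi> :: "'p::{countable, infinite} fm"
  shows "((\<exists>F :: 'w frame. CS4_frame F \<and> falsifiable_on F \<phi>) \<longrightarrow>
            (\<exists>G :: nat frame. CS4_frame G \<and> finite_frame G \<and> falsifiable_on G \<phi>)) \<and>
         ((\<exists>F :: 'w frame. CS4_frame F \<and> satisfiable_on F \<phi>) \<longrightarrow>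
            (\<exists>G :: nat frame. CS4_frame G \<and> finite_frame G \<and> satisfiable_on G \<phi>))"
  unfolding falsifiable_on_def satisfiable_on_def
proof (intro conjI impI; elim exE conjE)
  fix F :: "'w frame" and V :: "'p \<Rightarrow> 'w set" and w
  assume F: "CS4_frame F" "valuation F V" "w \<in> worlds F - fallible F"
  obtain G :: "nat frame" and U v where G: "CS4_frame G" "finite_frame G" "valuation G U"
    "v \<in> worlds G - fallible G" and iff: "sat G U v \<phi> \<longleftrightarrow> sat F V w \<phi>"
    using F by (rule finite_model_agreeing_on_formula)
  show "\<exists>G :: nat frame. CS4_frame G \<and> finite_frame G \<and>
      (\<exists>V w. valuation G V \<and> w \<in> worlds G - fallible G \<and> \<not> sat G V w \<phi>)"
    if "\<not> sat F V w \<phi>"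
    using G iff that by blast
  show "\<exists>G :: nat frame. CS4_frame G \<and> finite_frame G \<and>
      (\<exists>V w. valuation G V \<and> w \<in> worlds G - fallible G \<and> sat G V w \<phi>)"
    if "sat F V w \<phi>"
    using G iff that by blast
qed

end
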